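(* For each prime $p$, there holds for all integers $n \ge 1$, $$0 \le \mathrm{ord}_p(\overline{G}_n) < n \log_p n.$$ The value $n = p^k$ (with $k \ge 0$ an integer) has $\mathrm{ord}_p(\overline{G}_n) \ge n(\log_p n - 1)$.
   Context: For a positive integer $n$, $\overline{G}_n := \prod_{t=0}^n \binom{n}{t}$ is the product of the binomial coefficients in the $n$-th row of Pascal's triangle. For a prime $p$ and a positive integer $m$, $\mathrm{ord}_p(m)$ is the exponent of the largest power of $p$ dividing $m$; $\log_p$ is the logarithm to base $p$.
   Formalization: The strict upper bound fails at n = 1, where both sides equal 0 for every prime p; it is proved strictly for all n ≥ 2 and with ≤ at n = 1. *)

theory Defs
  imports Complex_Main "HOL-Computational_Algebra.Primes"
begin

definition Gbar :: "nat \<Rightarrow> nat" where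
  "Gbar n = (\<Prod>t = 0..n. n choose t)"

end

theory Submission imports Defs begin

text \<open>
  Write \<open>v\<close> for the \<open>p\<close>-adic valuation.

  The upper bound holds entry by entry: the power of \<open>p\<close> in \<open>n choose t\<close> never exceeds \<open>n\<close>, so
  \<open>v (n choose t)\<close> is at most \<open>log\<^sub>p n\<close>. The two outer entries of the row are 1, so only \<open>n - 1\<close>
  of the entries contribute, and this gap makes the estimate strict once \<open>n \<ge> 2\<close>. The entry-wise
  bound comes from Leibniz's harmonic triangle, whose entries are the reciprocals of
  \<open>n * ((n - 1) choose t) = (t + 1) * (n choose (t + 1))\<close>. Each entry is a difference of two entries
  of the previous column, and the first column is \<open>1 / n\<close>; hence every denominator in the first
  \<open>n\<close> rows divides every common multiple of \<open>1, \<dots>, n\<close>, and there is a common multiple in which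
  the power of \<open>p\<close> is at most \<open>n\<close>.

  The lower bound comes from multiplying the absorption identity
  \<open>t * (n choose t) = n * ((n - 1) choose (t - 1))\<close> over \<open>t = 1, \<dots>, n\<close>, which gives
  \<open>n! * Gbar n = n ^ n * Gbar (n - 1)\<close>. For \<open>n = p ^ k\<close> the right-hand side has valuation at least
  \<open>n * k\<close>, whereas \<open>v (n!) \<le> n\<close>.
\<close>

section \<open>Leibniz's harmonic triangle\<close>

text \<open>
  The recurrence \<open>1 / D(n,t+1) = 1 / D(n-1,t) - 1 / D(n,t)\<close> for \<open>D(n,t) = n * ((n - 1) choose t)\<close>,
  with denominators cleared and \<open>n = m + 2\<close>. By absorption \<open>D(n-1,t)\<close> is
  \<open>(t + 1) * ((m + 1) choose (t + 1))\<close>, which reduces it to absorption one row further down.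
\<close>

lemma leibniz_triangle_recurrence:
  fixes m t :: nat
  defines "D \<equiv> \<lambda>n t. n * ((n - 1) choose t)"
  shows "D (m + 2) (Suc t) * D (m + 2) t
    = D (m + 2) t * D (m + 1) t + D (m + 2) (Suc t) * D (m + 1) t"
proof -
  have absorb1: "D (m + 1) t = Suc t * (Suc m choose Suc t)"
    unfolding D_def using Suc_times_binomial[of t m] by simp
  have "(m + 2) * (Suc m choose t) = Suc t * (Suc (Suc m) choose Suc t)"
    using Suc_times_binomial[of t "Suc m"] by simp
  then have absorb2: "(m + 2) * (Suc m choose t) = Suc t * ((Suc m choose t) + (Suc m choose Suc t))"
    by simp
  have "D (m + 2) (Suc t) * D (m + 2) t
      = (m + 2) * (Suc m choose Suc t) * ((m + 2) * (Suc m choose t))"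
    unfolding D_def by simp
  also have "\<dots> = (m + 2) * (Suc m choose Suc t)
      * (Suc t * ((Suc m choose t) + (Suc m choose Suc t)))"
    unfolding absorb2 ..
  also have "\<dots> = D (m + 2) t * D (m + 1) t + D (m + 2) (Suc t) * D (m + 1) t"
    unfolding absorb1 by (simp add: D_def algebra_simps del: binomial_Suc_Suc)
  finally show ?thesis .
qed

text \<open>
  Multiplied by a common multiple \<open>M\<close> of \<open>1, \<dots>, n\<close>, the first column of the harmonic triangle
  becomes integral, and the recurrence passes integrality on from column to column.
\<close>

lemma leibniz_denominator_dvd_common_multiple:
  fixes M n t :: nat
  assumes "\<And>k. k \<in> {1..n} \<Longrightarrow> k dvd M" and "t < n"
  shows "n * ((n - 1) choose t) dvd M"
  using assms
proof (induction t arbitrary: n)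
  case 0
  then show ?case by simp
next
  case (Suc t)
  then obtain m where n: "n = m + 2"
    by (metis add_2_eq_Suc' less_natE add_Suc_right add_Suc)
  define a where "a = int (n * ((n - 1) choose t))"
  define b where "b = int ((m + 1) * (m choose t))"
  define c where "c = int (n * ((n - 1) choose Suc t))"
  have "n * ((n - 1) choose t) dvd M"
    using Suc.prems by (intro Suc.IH) auto
  then have "a dvd int M" unfolding a_def by (simp only: int_dvd_int_iff)
  then obtain x where x: "int M = a * x" ..
  have "(m + 1) * (((m + 1) - 1) choose t) dvd M"
    using Suc.prems n by (intro Suc.IH) auto
  then have "b dvd int M" unfolding b_def by (simp only: int_dvd_int_iff add_diff_cancel_right')
  then obtain y where y: "int M = b * y" ..
  have rec: "c * a = a * b + c * b"
    using arg_cong[OF leibniz_triangle_recurrence[of m t], of int]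
    unfolding a_def b_def c_def n of_nat_mult of_nat_add by simp
  have "a * b \<noteq> 0"
    unfolding a_def b_def of_nat_mult[symmetric] of_nat_eq_0_iff
    using Suc.prems n by (simp add: binomial_eq_0_iff)
  \<comment> \<open>The quotient \<open>M / c\<close> is \<open>M / b - M / a\<close>, so \<open>y - x\<close> is the cofactor.\<close>
  moreover have "(a * b) * (c * (y - x)) = (a * b) * int M"
  proof -
    have "(a * b) * (c * (y - x)) = c * a * (b * y) - c * b * (a * x)"
      by (simp add: algebra_simps)
    also have "\<dots> = (c * a - c * b) * int M"
      unfolding x[symmetric] y[symmetric] by (simp add: algebra_simps)
    finally show ?thesis using rec by simp
  qed
  ultimately have "int M = c * (y - x)"
    by simp
  then have "c dvd int M" ..
  then show ?case unfolding c_def by (simp only: int_dvd_int_iff)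
qed

section \<open>Valuations of a single binomial coefficient and of a factorial\<close>

text \<open>
  With \<open>L\<close> the largest exponent such that \<open>p ^ L \<le> n\<close>, the common multiple of \<open>1, \<dots>, n\<close> to use is
  \<open>p ^ L\<close> times the product of the parts of \<open>1, \<dots>, n\<close> that are prime to \<open>p\<close>. Its valuation is \<open>L\<close>,
  and \<open>n choose t\<close> divides it.
\<close>

lemma prime_power_multiplicity_binomial_le:
  fixes p n t :: nat
  assumes p: "prime p" and n: "1 \<le> n" and "t \<le> n"
  shows "p ^ multiplicity p (n choose t) \<le> n"
proof (cases t)
  case 0
  then show ?thesis using n by simp
next
  case (Suc s)
  have p2: "2 \<le> p" using p by (rule prime_ge_2_nat)
  obtain L where L: "p ^ L \<le> n" "n < p ^ (L + 1)"
    using ex_power_ivl1[OF p2 n] by auto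
  define c where "c k = k div p ^ multiplicity p k" for k :: nat
  define Q where "Q = (\<Prod>k = 1..n. c k)"
  have "k dvd p ^ L * Q" if k: "k \<in> {1..n}" for k
  proof -
    have "p ^ multiplicity p k \<le> k"
      using k by (intro dvd_imp_le multiplicity_dvd) auto
    then have "p ^ multiplicity p k < p ^ (L + 1)" using k L by auto
    then have "multiplicity p k < L + 1" using p2 by (simp only: power_strict_increasing_iff)
    then have "multiplicity p k \<le> L" by simp
    then have "p ^ multiplicity p k dvd p ^ L" by (rule le_imp_power_dvd)
    moreover have "c k dvd Q" unfolding Q_def using k by (intro dvd_prodI) auto
    ultimately have "p ^ multiplicity p k * c k dvd p ^ L * Q" by (rule mult_dvd_mono)
    then show ?thesis unfolding c_def by (simp add: multiplicity_dvd)
  qed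
  then have "n * ((n - 1) choose s) dvd p ^ L * Q"
    using assms Suc by (intro leibniz_denominator_dvd_common_multiple) auto
  then have "(n choose t) dvd p ^ L * Q"
    unfolding Suc using binomial_absorption[of s n] by (metis dvd_mult_right)
  then have "p ^ multiplicity p (n choose t) dvd p ^ L * Q"
    using multiplicity_dvd dvd_trans by blast
  moreover have "coprime (p ^ multiplicity p (n choose t)) Q"
  proof -
    have "\<not> p dvd c k" if "k \<in> {1..n}" for k
      unfolding c_def using that p by (intro multiplicity_decompose) auto
    then have "\<not> p dvd Q"
      unfolding Q_def using p by (simp add: prime_dvd_prod_iff)
    then show ?thesis using p by (simp add: prime_imp_coprime)
  qed
  ultimately have "p ^ multiplicity p (n choose t) dvd p ^ L"
    by (simp add: coprime_dvd_mult_left_iff)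
  then have "p ^ multiplicity p (n choose t) \<le> p ^ L"
    using p2 by (intro dvd_imp_le) auto
  then show ?thesis using L by simp
qed

text \<open>
  One step of Legendre's formula: only the multiples \<open>p, 2 p, \<dots>\<close> up to \<open>n\<close> contribute, and
  dividing each of them by \<open>p\<close> leaves \<open>(n div p)!\<close>.
\<close>

lemma multiplicity_fact_div:
  fixes p n :: nat
  assumes p: "prime p"
  shows "multiplicity p (fact n :: nat) = n div p + multiplicity p (fact (n div p) :: nat)"
proof (induction n)
  case 0
  then show ?case by simp
next
  case (Suc n)
  have pe: "prime_elem p" and p0: "p > 0" using p by (auto simp: prime_gt_0_nat)
  have step: "multiplicity p (fact (Suc j) :: nat) = multiplicity p (Suc j) + multiplicity p (fact j :: nat)"
    for j
    using prime_elem_multiplicity_mult_distrib[OF pe, of "Suc j" "fact j"]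
    by (simp del: mult_Suc)
  show ?case
  proof (cases "p dvd Suc n")
    case True
    then have d: "Suc n div p = Suc (n div p)"
      using p0 by (simp add: div_Suc dvd_eq_mod_eq_0)
    have "Suc n = p * Suc (n div p)" using True d by (metis dvd_mult_div_cancel)
    then have "multiplicity p (Suc n) = Suc (multiplicity p (Suc (n div p)))"
      using pe by (metis multiplicity_times_same nat.distinct(1) not_prime_elem_zero prime_elem_def)
    then show ?thesis unfolding d step Suc.IH by simp
  next
    case False
    then have "Suc n div p = n div p" by (simp add: div_Suc dvd_eq_mod_eq_0)
    then show ?thesis using False step[of n] Suc.IH by (simp add: not_dvd_imp_multiplicity_0)
  qed
qed

text \<open>
  By strong induction the two summands \<open>n div p\<close> and \<open>v ((n div p)!)\<close> are each at most \<open>n div p\<close>,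
  and \<open>2 \<le> p\<close>.
\<close>

lemma multiplicity_fact_le:
  fixes p n :: nat
  assumes p: "prime p"
  shows "multiplicity p (fact n :: nat) \<le> n"
proof (induction n rule: less_induct)
  case (less n)
  show ?case
  proof (cases "n = 0")
    case False
    have p2: "2 \<le> p" using p by (rule prime_ge_2_nat)
    have "multiplicity p (fact n :: nat) = n div p + multiplicity p (fact (n div p) :: nat)"
      using p by (rule multiplicity_fact_div)
    also have "\<dots> \<le> 2 * (n div p)"
      using less.IH[of "n div p"] False p2 by simp
    also have "\<dots> \<le> p * (n div p)" using p2 by (rule mult_le_mono1)
    also have "\<dots> \<le> n" by simp
    finally show ?thesis .
  qed simp
qed

section \<open>Products over a row of Pascal's triangle\<close>

lemma Gbar_pos: "0 < Gbar n"
  unfolding Gbar_def by (intro prod_pos) auto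

lemma fact_times_Gbar_Suc: "fact (Suc m) * Gbar (Suc m) = Suc m ^ Suc m * Gbar m"
proof -
  have "fact (Suc m) * Gbar (Suc m) = (\<Prod>t = 0..m. Suc t) * (\<Prod>t = 0..m. Suc m choose Suc t)"
    unfolding Gbar_def fact_prod_Suc
    by (simp add: prod.atLeast0_atMost_Suc_shift atLeastLessThanSuc_atLeastAtMost
        del: prod.cl_ivl_Suc prod.op_ivl_Suc binomial_Suc_Suc)
  also have "\<dots> = (\<Prod>t = 0..m. Suc m * (m choose t))"
    unfolding prod.distrib[symmetric] Suc_times_binomial ..
  also have "\<dots> = Suc m ^ Suc m * Gbar m"
    unfolding Gbar_def prod.distrib by simp
  finally show ?thesis .
qed

lemma multiplicity_Gbar:
  assumes "prime p"
  shows "multiplicity p (Gbar n) = (\<Sum>t = 0..n. multiplicity p (n choose t))"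
  unfolding Gbar_def using assms
  by (intro prime_elem_multiplicity_prod_distrib) (auto simp: binomial_eq_0_iff)

lemma multiplicity_Gbar_le:
  fixes p n :: nat
  assumes p: "prime p" and n: "1 \<le> n"
  shows "real (multiplicity p (Gbar n)) \<le> (real n - 1) * log p n"
proof -
  have p1: "1 < p" using p by (rule prime_gt_1_nat)
  have bound: "real (multiplicity p (n choose t)) \<le> log p n" if "t \<le> n" for t
  proof (rule le_log_of_power)
    show "real p ^ multiplicity p (n choose t) \<le> real n"
      using prime_power_multiplicity_binomial_le[OF p n that] by (metis of_nat_le_iff of_nat_power)
  qed (use p1 in simp)
  have "multiplicity p (Gbar n) = (\<Sum>t = 1..<n. multiplicity p (n choose t))"
    unfolding multiplicity_Gbar[OF p]
  proof (rule sum.mono_neutral_right)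
    show "\<forall>t \<in> {0..n} - {1..<n}. multiplicity p (n choose t) = 0"
    proof
      fix t assume "t \<in> {0..n} - {1..<n}"
      then have "t = 0 \<or> t = n" by auto
      then show "multiplicity p (n choose t) = 0" by auto
    qed
  qed auto
  then have "real (multiplicity p (Gbar n)) = (\<Sum>t = 1..<n. real (multiplicity p (n choose t)))"
    by simp
  also have "\<dots> \<le> (\<Sum>t = 1..<n. log p n)"
    by (intro sum_mono bound) auto
  also have "\<dots> = (real n - 1) * log p n" using n by (simp add: of_nat_diff)
  finally show ?thesis .
qed

lemma multiplicity_Gbar_prime_power_ge:
  fixes p k :: nat
  assumes p: "prime p"
  shows "p ^ k * k \<le> multiplicity p (Gbar (p ^ k)) + p ^ k"
proof -
  define n where "n = p ^ k"
  have pe: "prime_elem p" using p by simp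
  have "n \<noteq> 0" unfolding n_def using p by auto
  then obtain m where m: "n = Suc m" using not0_implies_Suc by auto
  have "multiplicity p (n ^ n) = n * k"
    using prime_elem_multiplicity_power_distrib[OF pe \<open>n \<noteq> 0\<close>, of n] pe by (simp add: n_def)
  then have "n * k \<le> multiplicity p (n ^ n * Gbar m)"
    using prime_elem_multiplicity_mult_distrib[OF pe, of "n ^ n" "Gbar m"] \<open>n \<noteq> 0\<close> Gbar_pos[of m]
    by simp
  also have "n ^ n * Gbar m = fact n * Gbar n"
    unfolding m by (rule fact_times_Gbar_Suc[symmetric])
  also have "multiplicity p (fact n * Gbar n) = multiplicity p (fact n :: nat) + multiplicity p (Gbar n)"
    using Gbar_pos[of n] by (intro prime_elem_multiplicity_mult_distrib[OF pe]) auto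
  also have "\<dots> \<le> n + multiplicity p (Gbar n)"
    using multiplicity_fact_le[OF p] by simp
  finally show ?thesis unfolding n_def by simp
qed

text \<open>
  For \<open>n = 1\<close> both sides of the upper bound are 0. For \<open>n \<ge> 2\<close> the logarithm is positive, so
  \<open>n - 1\<close> copies of it are strictly less than \<open>n\<close>.
\<close>

theorem theorem6p8:
  fixes p :: nat
  assumes "prime p"
  shows "(\<forall>n::nat. n \<ge> 1 \<longrightarrow>
            0 \<le> real (multiplicity p (Gbar n)) \<and>
            real (multiplicity p (Gbar n)) \<le> real n * log (real p) (real n) \<and>
            (n \<noteq> 1 \<longrightarrow> real (multiplicity p (Gbar n)) < real n * log (real p) (real n)))
       \<and> (\<forall>k n::nat. n = p ^ k \<longrightarrow>
            real (multiplicity p (Gbar n)) \<ge> real n * (log (real p) (real n) - 1))"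
proof (intro conjI allI impI)
  have p1: "1 < p" using assms by (rule prime_gt_1_nat)
  fix n :: nat
  assume n: "n \<ge> 1"
  show "0 \<le> real (multiplicity p (Gbar n))" by simp
  have upper: "real (multiplicity p (Gbar n)) \<le> real n * log p n - log p n"
    using multiplicity_Gbar_le[OF assms n] by (simp add: algebra_simps)
  have "0 \<le> log p n" using p1 n by simp
  with upper show "real (multiplicity p (Gbar n)) \<le> real n * log p n" by linarith
  assume "n \<noteq> 1"
  with n p1 have "0 < log p n" by simp
  with upper show "real (multiplicity p (Gbar n)) < real n * log p n" by linarith
next
  fix k n :: nat
  assume n: "n = p ^ k"
  have p1: "1 < p" using assms by (rule prime_gt_1_nat)
  have "log p n = k" using p1 by (simp add: n log_nat_power)
  moreover have "real (n * k) \<le> real (multiplicity p (Gbar n) + n)"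
    unfolding of_nat_le_iff n using multiplicity_Gbar_prime_power_ge[OF assms] .
  ultimately show "real (multiplicity p (Gbar n)) \<ge> real n * (log p n - 1)"
    by (simp add: algebra_simps)
qed

end
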